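(* Let $n>2$, let $p_1,\dots,p_{n-1},q$ be integers with $1+|p_{n-1}|+\dots+|p_1|<|q|$, and let $t(x)=x^n+p_{n-1}x^{n-1}+\dots+p_1x-q$. Then $\mathrm{Dom}_{\overline p,q}$ is regular and $\psi_{\overline p,q}:\mathrm{Dom}_{\overline p,q}\to\mathbb{Z}^n$ is an FA-presentation of $(\mathbb{Z}^n,+)$ (the addition relation on $\mathrm{Dom}_{\overline p,q}$ transported via $\psi_{\overline p,q}$ is FA-recognizable). If moreover $\gcd(p_1,q)=1$, then for none of the cyclic components $\langle\xi\rangle,\langle\eta_1\rangle,\dots,\langle\eta_{n-1}\rangle$ of $\mathbb{Z}^n=\langle\xi\rangle\oplus\langle\eta_1\rangle\oplus\dots\oplus\langle\eta_{n-1}\rangle$ is the preimage under $\psi_{\overline p,q}$ regular, and none of the projections of $\mathbb{Z}^n$ onto these components is FA-recognizable with respect to $\psi_{\overline p,q}$ (i.e. for each such projection $\pi$, the relation $\{(u,v):\psi_{\overline p,q}(v)=\pi(\psi_{\overline p,q}(u))\}$ is not FA-recognizable).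
   Context: For $f,g\in\mathbb{Z}[x]$ write $f\sim g$ if $t$ divides $f-g$; identify $\mathbb{Z}^n$ with the additive group of $\mathbb{Z}[x]/\langle t\rangle$ (basis the classes of $1,x,\dots,x^{n-1}$), and put $\xi=[1]_\sim$, $\eta_i=[x^i]_\sim$ for $i=1,\dots,n-1$; write $\overline p=\langle p_1,\dots,p_{n-1}\rangle$. Let $\Sigma_q=\{-(|q|-1),\dots,|q|-1\}$ ordered naturally; a string $a_0a_1\dots a_m\in\Sigma_q^*$ represents the polynomial $a_mx^m+\dots+a_0$, and two strings are equivalent if their polynomials are $\sim$-equivalent. $\mathrm{Dom}_{\overline p,q}$ is the set of $w\in\Sigma_q^*$ such that no string strictly smaller than $w$ in the length-lexicographic order is equivalent to $w$, and $\psi_{\overline p,q}(w)$ is the $\sim$-class of the polynomial represented by $w$. Convolution of strings pads shorter strings with a new symbol $\diamond$ and stacks them letterwise; a relation on strings is FA-recognizable if the set of convolutions of its tuples is accepted by a finite automaton; a function is FA-recognizable if its graph is. *)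

theory Defs
  imports "HOL-Computational_Algebra.Polynomial"
begin

text \<open>Regular languages: accepted by a deterministic automaton with finitely many
  (reachable) states.  Letters outside the intended alphabet can be sent to a sink.\<close>
definition regular :: "'a list set \<Rightarrow> bool" where
  "regular L \<longleftrightarrow> (\<exists>(Q :: nat set) (\<delta> :: nat \<Rightarrow> 'a \<Rightarrow> nat) s F.
      finite Q \<and> s \<in> Q \<and> (\<forall>q\<in>Q. \<forall>a. \<delta> q a \<in> Q) \<and>
      L = {w. foldl \<delta> s w \<in> F})"

definition conv :: "'a list list \<Rightarrow> 'a option list list" where
  "conv ws = map (\<lambda>i. map (\<lambda>w. if i < length w then Some (w ! i) else None) ws)
                 [0..<foldr (\<lambda>w m. max (length w) m) ws 0]"

definition FA_recognizable :: "'a list list set \<Rightarrow> bool" where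
  "FA_recognizable R \<longleftrightarrow> regular (conv ` R)"

definition tpoly :: "nat \<Rightarrow> (nat \<Rightarrow> int) \<Rightarrow> int \<Rightarrow> int poly" where
  "tpoly n p q = monom 1 n + (\<Sum>i=1..n-1. monom (p i) i) - [:q:]"

definition Sigma :: "int \<Rightarrow> int set" where
  "Sigma q = {-(\<bar>q\<bar>-1)..\<bar>q\<bar>-1}"

text \<open>The string a_0 a_1 ... a_m represents a_m x^m + ... + a_0, i.e. Poly w.\<close>
definition str_equiv :: "int poly \<Rightarrow> int list \<Rightarrow> int list \<Rightarrow> bool" where
  "str_equiv t u w \<longleftrightarrow> t dvd (Poly u - Poly w)"

definition Dom :: "nat \<Rightarrow> (nat \<Rightarrow> int) \<Rightarrow> int \<Rightarrow> int list set" where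
  "Dom n p q = {w \<in> lists (Sigma q).
      \<not> (\<exists>u \<in> lists (Sigma q). (u, w) \<in> lenlex {(a, b). a < b} \<and> str_equiv (tpoly n p q) u w)}"

definition cls :: "int poly \<Rightarrow> int poly \<Rightarrow> int poly set" where
  "cls t f = {g. t dvd (f - g)}"

definition psi :: "nat \<Rightarrow> (nat \<Rightarrow> int) \<Rightarrow> int \<Rightarrow> int list \<Rightarrow> int poly set" where
  "psi n p q w = cls (tpoly n p q) (Poly w)"

text \<open>Coordinate i of the class of f w.r.t. the basis [1],[x],...,[x^(n-1)]:
  coefficient of the unique reduced representative of degree < n.\<close>
definition coord :: "int poly \<Rightarrow> nat \<Rightarrow> int poly \<Rightarrow> nat \<Rightarrow> int" where
  "coord t n f i = coeff (THE r. degree r < n \<and> t dvd (f - r)) i"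

definition add_rel :: "nat \<Rightarrow> (nat \<Rightarrow> int) \<Rightarrow> int \<Rightarrow> int list list set" where
  "add_rel n p q = {[u, v, w] | u v w. u \<in> Dom n p q \<and> v \<in> Dom n p q \<and> w \<in> Dom n p q \<and>
      psi n p q w = cls (tpoly n p q) (Poly u + Poly v)}"

text \<open>Graph of the projection onto the i-th cyclic component <[x^i]> (i = 0 is xi).\<close>
definition proj_rel :: "nat \<Rightarrow> (nat \<Rightarrow> int) \<Rightarrow> int \<Rightarrow> nat \<Rightarrow> int list list set" where
  "proj_rel n p q i = {[u, v] | u v. u \<in> Dom n p q \<and> v \<in> Dom n p q \<and>
      psi n p q v = cls (tpoly n p q) (monom (coord (tpoly n p q) n (Poly u) i) i)}"

definition comp_preimage :: "nat \<Rightarrow> (nat \<Rightarrow> int) \<Rightarrow> int \<Rightarrow> nat \<Rightarrow> int list set" where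
  "comp_preimage n p q i = {w \<in> Dom n p q. \<exists>k::int. psi n p q w = cls (tpoly n p q) (monom k i)}"

end

theory Submission
  imports Defs
begin

text \<open>
  If \<open>t * h\<close> has coefficients bounded by \<open>B\<close>, comparing the largest coefficients of \<open>h\<close> with
  \<open>\<bar>q\<bar> > 1 + \<bar>p\<^sub>1\<bar> + \<dots>\<close> shows that \<open>h\<close> is bounded by \<open>B\<close> as well.  Hence testing whether a word over
  a bounded set of digits spells a multiple of \<open>t\<close> requires only finitely many carries, and that
  language is regular; the domain and the addition relation arise from it by Boolean
  operations, letterwise preimages and letterwise images.  Regularity is handled through
  finiteness of the set of residuals (Myhill--Nerode).

  If the preimage of a cyclic component were regular, two prefixes of different lengths would have the
  same infinite residual, which forces \<open>k x\<^sup>d \<equiv> l (mod t)\<close> with \<open>k \<noteq> 0\<close> and \<open>d > 0\<close>.  This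
  is impossible when \<open>p\<^sub>1\<close> is invertible modulo \<open>q\<close>.  The component consists of the fixed points of
  the projection, so the projection is not recognizable either.
\<close>

section \<open>Regular languages via residuals\<close>

definition residual :: "'a list set \<Rightarrow> 'a list \<Rightarrow> 'a list set" where
  "residual L w = {v. w @ v \<in> L}"

lemma residual_Nil [simp]: "residual L [] = L"
  by (simp add: residual_def)

lemma residual_residual: "residual (residual L u) w = residual L (u @ w)"
  by (simp add: residual_def)

lemma residual_Cons: "residual L (a # w) = residual (residual L [a]) w"
  by (simp add: residual_residual)

text \<open>Myhill-Nerode: a residual depends only on the state reached, and conversely the
  residuals themselves, coded injectively as naturals, serve as states.\<close>

lemma regular_iff_finite_residuals: "regular L \<longleftrightarrow> finite (range (residual L))"
proof
  assume "regular L"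
  then obtain Q :: "nat set" and \<delta> s F where Q: "finite Q" "s \<in> Q" "\<forall>q\<in>Q. \<forall>a. \<delta> q a \<in> Q"
    and L: "L = {w. foldl \<delta> s w \<in> F}"
    unfolding regular_def by blast
  have "foldl \<delta> x w \<in> Q" if "x \<in> Q" for w x
    using that Q(3) by (induction w arbitrary: x) auto
  then have "range (residual L) \<subseteq> (\<lambda>x. {v. foldl \<delta> x v \<in> F}) ` Q"
    using Q(2) by (fastforce simp: residual_def L)
  then show "finite (range (residual L))"
    using Q(1) finite_surj by blast
next
  assume fin: "finite (range (residual L))"
  let ?R = "range (residual L)"
  obtain f :: "'a list set \<Rightarrow> nat" where f: "inj_on f ?R"
    using finite_imp_inj_to_nat_seg[OF fin] by blast
  define \<delta> where "\<delta> k a = f (residual (inv_into ?R f k) [a])" for k a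
  have step: "\<delta> (f (residual L u)) a = f (residual L (u @ [a]))" for u a
    using f by (simp add: \<delta>_def residual_residual)
  have run: "foldl \<delta> (f (residual L u)) w = f (residual L (u @ w))" for u w
  proof (induction w arbitrary: u)
    case (Cons a w)
    show ?case using Cons[of "u @ [a]"] by (simp add: step)
  qed simp
  have "w \<in> L \<longleftrightarrow> foldl \<delta> (f L) w \<in> f ` {R \<in> ?R. [] \<in> R}" for w
  proof -
    have "foldl \<delta> (f L) w = f (residual L w)"
      using run[of "[]" w] by simp
    moreover have "f (residual L w) \<in> f ` {R \<in> ?R. [] \<in> R} \<longleftrightarrow> [] \<in> residual L w"
      using inj_on_image_mem_iff[OF f, of "residual L w" "{R \<in> ?R. [] \<in> R}"] by auto
    ultimately show ?thesis by (simp add: residual_def)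
  qed
  moreover have "f L \<in> f ` ?R"
    by (metis rangeI imageI residual_Nil)
  ultimately show "regular L"
    unfolding regular_def using fin step
    by (intro exI[of _ "f ` ?R"] exI[of _ \<delta>] exI[of _ "f L"] exI[of _ "f ` {R \<in> ?R. [] \<in> R}"]) auto
qed

lemma regularI_residuals:
  assumes "finite A" and "\<And>w. residual L w \<in> A"
  shows "regular L"
  unfolding regular_iff_finite_residuals using assms by (meson finite_subset image_subsetI)

lemma regular_combine:
  assumes "regular L" "regular M" and "\<And>w. residual K w = F (residual L w) (residual M w)"
  shows "regular K"
  by (rule regularI_residuals[of "(\<lambda>(A, B). F A B) ` (range (residual L) \<times> range (residual M))"])
    (use assms in \<open>auto simp: regular_iff_finite_residuals\<close>)

lemma regular_Int: "regular L \<Longrightarrow> regular M \<Longrightarrow> regular (L \<inter> M)"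
  by (rule regular_combine[of L M _ "(\<inter>)"]) (auto simp: residual_def)

lemma regular_Un: "regular L \<Longrightarrow> regular M \<Longrightarrow> regular (L \<union> M)"
  by (rule regular_combine[of L M _ "(\<union>)"]) (auto simp: residual_def)

lemma regular_Diff: "regular L \<Longrightarrow> regular M \<Longrightarrow> regular (L - M)"
  by (rule regular_combine[of L M _ "(-)"]) (auto simp: residual_def)

lemma regular_vimage_map:
  assumes "regular L"
  shows "regular {w. map f w \<in> L}"
  by (rule regularI_residuals[of "(\<lambda>R. {w. map f w \<in> R}) ` range (residual L)"])
    (use assms in \<open>auto simp: regular_iff_finite_residuals residual_def\<close>)

text \<open>The residual of a letterwise image is a union of residuals of the original language.\<close>
lemma regular_image_map:
  assumes "regular L"
  shows "regular (map f ` L)"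
proof (rule regularI_residuals)
  show "finite ((\<lambda>S. map f ` \<Union>S) ` Pow (range (residual L)))"
    using assms by (simp add: regular_iff_finite_residuals)
  fix w
  have "residual (map f ` L) w = map f ` \<Union>(residual L ` {u. map f u = w})"
  proof (intro equalityI subsetI)
    fix v assume "v \<in> residual (map f ` L) w"
    then obtain z where "z \<in> L" "map f z = w @ v"
      by (auto simp: residual_def)
    then show "v \<in> map f ` \<Union>(residual L ` {u. map f u = w})"
      by (auto simp: residual_def map_eq_append_conv)
  next
    fix v assume "v \<in> map f ` \<Union>(residual L ` {u. map f u = w})"
    then obtain u z where "map f u = w" "v = map f z" "u @ z \<in> L"
      by (auto simp: residual_def)
    then show "v \<in> residual (map f ` L) w"
      by (auto simp: residual_def intro!: image_eqI[of _ _ "u @ z"])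
  qed
  then show "residual (map f ` L) w \<in> (\<lambda>S. map f ` \<Union>S) ` Pow (range (residual L))"
    by (rule image_eqI) auto
qed

lemma regular_lists: "regular (lists A)"
  by (rule regularI_residuals[of "{lists A, {}}"]) (auto simp: residual_def)

lemma regular_last: "regular {w. w \<noteq> [] \<and> P (last w)}" (is "regular ?L")
proof (rule regularI_residuals)
  have "residual ?L w = (if w \<in> ?L then insert [] ?L else ?L)" for w
    by (auto simp: residual_def last_append)
  then show "residual ?L w \<in> {?L, insert [] ?L}" for w
    by simp
qed simp

text \<open>\<open>lex\<close> compares words of equal length, so the first position with different
  letters decides: the comparison is undecided, won (\<open>UNIV\<close>) or lost
  (\<open>{}\<close>).\<close>

lemma regular_lex:
  assumes "irrefl r"
  shows "regular {z. (map fst z, map snd z) \<in> lex r}" (is "regular ?L")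
proof (rule regularI_residuals)
  show "residual ?L w \<in> {?L, UNIV, {}}" for w
  proof (induction w)
    case (Cons c w)
    have "residual ?L [c] = (if (fst c, snd c) \<in> r then UNIV else if fst c = snd c then ?L else {})"
      using assms by (auto simp: residual_def irrefl_def)
    moreover have "residual UNIV w = UNIV" "residual {} w = {}"
      by (auto simp: residual_def)
    ultimately show ?case
      using Cons by (simp add: residual_Cons[of _ c w])
  qed simp
qed simp

section \<open>Padded words and tracks of a convolution\<close>

definition padded :: "'a list set \<Rightarrow> 'a option list set" where
  "padded L = {map Some u @ replicate k None | u k. u \<in> L}"

lemma residual_padded_Some: "residual (padded L) [Some a] = padded (residual L [a])"
proof -
  have "Some a # v \<in> padded L \<longleftrightarrow> v \<in> padded (residual L [a])" for v
  proof
    assume "Some a # v \<in> padded L"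
    then obtain u k where *: "Some a # v = map Some u @ replicate k None" "u \<in> L"
      by (auto simp: padded_def)
    then obtain u' where "u = a # u'"
      by (cases u; cases k) auto
    with * show "v \<in> padded (residual L [a])"
      by (auto simp: padded_def residual_def)
  next
    assume "v \<in> padded (residual L [a])"
    then obtain u k where "v = map Some u @ replicate k None" "a # u \<in> L"
      by (auto simp: padded_def residual_def)
    then have "Some a # v = map Some (a # u) @ replicate k None" "a # u \<in> L"
      by auto
    then show "Some a # v \<in> padded L"
      unfolding padded_def by blast
  qed
  then show ?thesis by (auto simp: residual_def)
qed

lemma residual_padded_None:
  "residual (padded L) [None] = (if [] \<in> L then lists {None} else {})"
proof -
  have "v \<in> residual (padded L) [None] \<longleftrightarrow> [] \<in> L \<and> v \<in> lists {None}" for v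
  proof
    assume "v \<in> residual (padded L) [None]"
    then obtain u k where "None # v = map Some u @ replicate k None" "u \<in> L"
      by (auto simp: residual_def padded_def)
    then show "[] \<in> L \<and> v \<in> lists {None}"
      by (cases u; cases k) auto
  next
    assume v: "[] \<in> L \<and> v \<in> lists {None}"
    then obtain k where "v = replicate k None"
      using replicate_eqI[of v "length v" None] by blast
    then have "None # v = map Some [] @ replicate (Suc k) None"
      by simp
    then show "v \<in> residual (padded L) [None]"
      using v unfolding residual_def padded_def append_Cons append_Nil mem_Collect_eq by blast
  qed
  then show ?thesis by auto
qed

text \<open>After the first blank only blanks may follow, so reading beyond it leaves only
  \<open>lists {None}\<close> and \<open>{}\<close> as further residuals.\<close>

lemma regular_padded:
  assumes "regular L"
  shows "regular (padded L)"
proof (rule regularI_residuals)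
  let ?A = "padded ` range (residual L) \<union> {lists {None}, {}}"
  show "finite ?A"
    using assms by (simp add: regular_iff_finite_residuals)
  have "residual (padded (residual L u)) w \<in> ?A" for u w
  proof (induction w arbitrary: u)
    case (Cons c w)
    have "residual (lists {None}) w \<in> {lists {None}, {}}" "residual {} w = {}"
      by (auto simp: residual_def)
    with Cons show ?case
      by (cases c) (auto simp: residual_Cons[of _ _ w] residual_padded_Some residual_padded_None
          residual_residual)
  qed auto
  from this[of "[]"] show "residual (padded L) w \<in> ?A" for w
    by simp
qed

definition track :: "'a list \<Rightarrow> nat \<Rightarrow> 'a option" where
  "track w i = (if i < length w then Some (w ! i) else None)"

lemma map_in_padded_iff:
  "map f z \<in> padded L \<longleftrightarrow>
    (\<exists>u\<in>L. length u \<le> length z \<and> (\<forall>i<length z. f (z ! i) = track u i))" (is "?l \<longleftrightarrow> ?r")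
proof
  assume ?l
  then obtain u k where u: "u \<in> L" and z: "map f z = map Some u @ replicate k None"
    by (auto simp: padded_def)
  have len: "length z = length u + k"
    using arg_cong[OF z, of length] by simp
  have "f (z ! i) = track u i" if "i < length z" for i
    using that len arg_cong[OF z, of "\<lambda>l. l ! i"] by (auto simp: track_def nth_append)
  with u len show ?r by (metis le_add1)
next
  assume ?r
  then obtain u where u: "u \<in> L" "length u \<le> length z" "\<forall>i<length z. f (z ! i) = track u i"
    by auto
  then have "map f z = map Some u @ replicate (length z - length u) None"
    by (intro nth_equalityI) (auto simp: track_def nth_append)
  with u(1) show ?l by (auto simp: padded_def)
qed

lemma conv_three:
  "conv [u, v, w] = map (\<lambda>i. [track u i, track v i, track w i])
     [0..<max (length u) (max (length v) (length w))]"
  by (simp add: conv_def track_def)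

lemma conv_diagonal: "conv [w, w] = map (\<lambda>a. [Some a, Some a]) w"
  by (rule nth_equalityI) (auto simp: conv_def)

text \<open>A diagonal letter contains no blank, so both words extend exactly as far as
  \<open>w\<close>.\<close>

lemma conv_eq_diagonalD:
  assumes "conv [u, v] = map (\<lambda>a. [Some a, Some a]) w"
  shows "u = w \<and> v = w"
proof -
  have len: "max (length u) (length v) = length w"
    using arg_cong[OF assms, of length] by (simp add: conv_def)
  have *: "i < length u \<and> i < length v \<and> u ! i = w ! i \<and> v ! i = w ! i" if "i < length w" for i
    using arg_cong[OF assms, of "\<lambda>l. l ! i"] that len
    by (simp add: conv_def del: upt.simps split: if_splits)
  have "length w \<le> length u" "length w \<le> length v"
    using *[of "length u"] *[of "length v"] linorder_le_less_linear by blast+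
  with len have "length u = length w" "length v = length w"
    by linarith+
  with * show ?thesis
    by (simp add: list_eq_iff_nth_eq)
qed

text \<open>By pigeonhole over the finitely many prefixes of each length, an infinite regular language has
  infinite residuals at prefixes of every length, and two of these residuals coincide.\<close>
lemma regular_infinite_shared_residual:
  assumes reg: "regular L" and inf: "infinite L" and sub: "L \<subseteq> lists A" and fin: "finite A"
  obtains u w where "length u < length w" "residual L u = residual L w" "infinite (residual L u)"
proof -
  have "\<exists>w. length w = m \<and> infinite (residual L w)" for m
  proof (rule ccontr)
    assume *: "\<nexists>w. length w = m \<and> infinite (residual L w)"
    have "L \<subseteq> {w. set w \<subseteq> A \<and> length w \<le> m} \<union>
        (\<Union>u\<in>{w. set w \<subseteq> A \<and> length w = m}. (@) u ` residual L u)"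
    proof
      fix w assume w: "w \<in> L"
      then have "set w \<subseteq> A" using sub by auto
      moreover have "w \<in> (@) (take m w) ` residual L (take m w)"
        using w by (auto simp: residual_def intro!: image_eqI[of _ _ "drop m w"])
      moreover have "set (take m w) \<subseteq> A" using \<open>set w \<subseteq> A\<close> set_take_subset by fastforce
      ultimately show "w \<in> {w. set w \<subseteq> A \<and> length w \<le> m} \<union>
        (\<Union>u\<in>{w. set w \<subseteq> A \<and> length w = m}. (@) u ` residual L u)"
        by (cases "length w \<le> m") auto
    qed
    moreover have "finite (\<Union>u\<in>{w. set w \<subseteq> A \<and> length w = m}. (@) u ` residual L u)"
      using * finite_lists_length_eq[OF fin, of m] by (intro finite_UN_I) auto
    ultimately show False
      using inf finite_lists_length_le[OF fin, of m] by (meson finite_UnI finite_subset)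
  qed
  then obtain W where W: "\<And>m. length (W m) = m" "\<And>m. infinite (residual L (W m))"
    by metis
  have "\<not> inj (\<lambda>m. residual L (W m))"
  proof
    assume "inj (\<lambda>m. residual L (W m))"
    then have "infinite (range (\<lambda>m. residual L (W m)))"
      using finite_imageD infinite_UNIV_nat by blast
    moreover have "range (\<lambda>m. residual L (W m)) \<subseteq> range (residual L)"
      by auto
    ultimately show False
      using reg finite_subset by (auto simp: regular_iff_finite_residuals)
  qed
  then obtain i j where "i \<noteq> j" "residual L (W i) = residual L (W j)"
    by (auto simp: inj_def)
  then show thesis
    using that[of "W i" "W j"] that[of "W j" "W i"] W by (metis nat_neq_iff)
qed

section \<open>Integer polynomials and the sum of absolute coefficients\<close>

text \<open>The l1 norm: it controls how multiplication enlarges coefficients, and it drives the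
  descent that produces digit strings.\<close>

definition norm1 :: "int poly \<Rightarrow> int" where
  "norm1 f = (\<Sum>c\<leftarrow>coeffs f. \<bar>c\<bar>)"

lemma norm1_0 [simp]: "norm1 0 = 0"
  by (simp add: norm1_def)

lemma norm1_pCons [simp]: "norm1 (pCons a f) = \<bar>a\<bar> + norm1 f"
  by (cases "f = 0"; cases "a = 0") (simp_all add: norm1_def cCons_def)

lemma norm1_nonneg: "0 \<le> norm1 f"
  by (induction f) auto

lemma norm1_smult: "norm1 (smult k f) = \<bar>k\<bar> * norm1 f"
  by (induction f) (auto simp: abs_mult algebra_simps)

lemma norm1_add: "norm1 (f + g) \<le> norm1 f + norm1 g"
  by (induction f g rule: poly_induct2) auto

lemma norm1_monom [simp]: "norm1 (monom c i) = \<bar>c\<bar>"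
  by (induction i) (simp_all add: monom_0 monom_Suc)

lemma norm1_sum: "norm1 (\<Sum>i\<in>A. f i) \<le> (\<Sum>i\<in>A. norm1 (f i))"
  by (induction A rule: infinite_finite_induct) (auto intro: order_trans[OF norm1_add])

text \<open>Horner induction: \<open>pCons a f * h\<close> is \<open>smult a h\<close> plus the
  shift of \<open>f * h\<close>, and the bounds add up.\<close>

lemma abs_coeff_mult_le:
  assumes "\<And>j. \<bar>coeff h j\<bar> \<le> M"
  shows "\<bar>coeff (f * h) i\<bar> \<le> norm1 f * M"
proof (induction f arbitrary: i)
  case (pCons a f)
  have M: "0 \<le> M" using assms[of 0] by linarith
  have "\<bar>coeff (pCons 0 (f * h)) i\<bar> \<le> norm1 f * M"
    using pCons.IH M by (cases i) (auto simp: norm1_nonneg)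
  moreover have "\<bar>a * coeff h i\<bar> \<le> \<bar>a\<bar> * M"
    using assms[of i] by (simp add: abs_mult mult_left_mono)
  ultimately show ?case
    by (simp add: distrib_right)
qed simp

lemma finite_polys_bounded: "finite {f :: int poly. degree f < n \<and> (\<forall>i. \<bar>coeff f i\<bar> \<le> C)}"
proof (rule finite_surj)
  show "finite {l. set l \<subseteq> {-C..C} \<and> length l = n}"
    by (rule finite_lists_length_eq) simp
  show "{f. degree f < n \<and> (\<forall>i. \<bar>coeff f i\<bar> \<le> C)} \<subseteq> Poly ` {l. set l \<subseteq> {-C..C} \<and> length l = n}"
  proof
    fix f :: "int poly" assume f: "f \<in> {f. degree f < n \<and> (\<forall>i. \<bar>coeff f i\<bar> \<le> C)}"
    then have "f = Poly (map (coeff f) [0..<n])"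
      by (auto simp: poly_eq_iff nth_default_def coeff_eq_0)
    moreover have "map (coeff f) [0..<n] \<in> {l. set l \<subseteq> {-C..C} \<and> length l = n}"
      using f by (auto simp: abs_le_iff minus_le_iff)
    ultimately show "f \<in> Poly ` {l. set l \<subseteq> {-C..C} \<and> length l = n}" by blast
  qed
qed

lemma coeff_Poly_bounded: "set (l :: int list) \<subseteq> {-B..B} \<Longrightarrow> 0 \<le> B \<Longrightarrow> \<bar>coeff (Poly l) i\<bar> \<le> B"
proof (cases "i < length l")
  case True
  assume "set l \<subseteq> {-B..B}" "0 \<le> B"
  then have "l ! i \<in> {-B..B}" using True nth_mem by blast
  then show ?thesis using True by (auto simp: nth_default_def)
qed (simp add: nth_default_def)

lemma dvd_diff_trans:
  fixes t :: "'a :: comm_ring_1"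
  shows "t dvd a - b \<Longrightarrow> t dvd b - c \<Longrightarrow> t dvd a - c"
  using dvd_add[of t "a - b" "b - c"] by simp

lemma dvd_diff_sym:
  fixes t :: "'a :: comm_ring_1"
  shows "t dvd a - b \<Longrightarrow> t dvd b - a"
  by (subst dvd_minus_iff[symmetric]) simp

lemma cls_eq_iff: "cls t f = cls t g \<longleftrightarrow> t dvd f - g"
proof
  assume "cls t f = cls t g"
  then have "g \<in> cls t f" by (simp add: cls_def)
  then show "t dvd f - g" by (simp add: cls_def)
next
  assume "t dvd f - g"
  then show "cls t f = cls t g"
    unfolding cls_def by (auto intro: dvd_diff_trans dvd_diff_sym)
qed

section \<open>The polynomial \<open>t\<close> and its expansion property\<close>

locale expanding =
  fixes n :: nat and p :: "nat \<Rightarrow> int" and q :: int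
  assumes n2: "2 \<le> n"
    and q_large: "1 + (\<Sum>i=1..n-1. \<bar>p i\<bar>) < \<bar>q\<bar>"
begin

abbreviation "t \<equiv> tpoly n p q"

text \<open>This is (t + q) / x: modulo \<open>t\<close>, the constant \<open>q\<close> may be
  exchanged for x times \<open>s\<close>, which is the carry rule.\<close>

definition s :: "int poly" where
  "s = monom 1 (n - 1) + (\<Sum>i=1..n-1. monom (p i) (i - 1))"

lemma t_eq: "t = pCons (- q) s"
proof (rule poly_eqI)
  fix j
  show "coeff t j = coeff (pCons (- q) s) j"
  proof (cases j)
    case 0
    then show ?thesis using n2 by (simp add: tpoly_def coeff_sum)
  next
    case (Suc m)
    have "(\<Sum>i = Suc 0..n - Suc 0. if i = Suc m then p i else 0) =
        (\<Sum>i = Suc 0..n - Suc 0. if i - Suc 0 = m then p i else 0)"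
      by (rule sum.cong) auto
    with Suc n2 show ?thesis by (auto simp: tpoly_def s_def coeff_sum)
  qed
qed

lemma norm1_s: "norm1 s < \<bar>q\<bar>"
proof -
  have "norm1 s \<le> 1 + (\<Sum>i=1..n-1. \<bar>p i\<bar>)"
    using norm1_add[of "monom 1 (n - 1)" "\<Sum>i=1..n-1. monom (p i) (i - 1)"]
      norm1_sum[of "\<lambda>i. monom (p i) (i - 1)" "{1..n-1}"]
    by (simp add: s_def)
  with q_large show ?thesis by simp
qed

lemma q_ge_2: "2 \<le> \<bar>q\<bar>"
  using q_large sum_nonneg[of "{1..n-1}" "\<lambda>i. \<bar>p i\<bar>"] by linarith

lemma q_nz: "q \<noteq> 0"
  using q_ge_2 by auto

lemma coeff_s_top: "coeff s (n - 1) = 1"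
  using n2 by (auto simp: s_def coeff_sum intro!: sum.neutral)

lemma coeff_s_0: "coeff s 0 = p 1"
proof -
  have "(\<Sum>i=1..n-1. if i - 1 = 0 then p i else 0) = (\<Sum>i\<in>{1}. p i)"
    using n2 by (intro sum.mono_neutral_cong_right) auto
  then show ?thesis using n2 by (simp add: s_def coeff_sum)
qed

lemma degree_s: "degree s = n - 1"
proof (rule antisym)
  show "degree s \<le> n - 1"
    by (rule degree_le) (auto simp: s_def coeff_sum intro!: sum.neutral)
  show "n - 1 \<le> degree s"
    using coeff_s_top by (intro le_degree) simp
qed

lemma s_nz: "s \<noteq> 0"
  using coeff_s_top by force

lemma degree_t: "degree t = n"
  using n2 s_nz by (simp add: t_eq degree_s)

lemma coeff_t_mult: "coeff (t * h) i = - q * coeff h i + coeff (pCons 0 (s * h)) i"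
  by (simp add: t_eq)

lemma t_dvd_small: "t dvd f \<Longrightarrow> degree f < n \<Longrightarrow> f = 0"
  using dvd_imp_degree_le[of t f] by (auto simp: degree_t)

text \<open>The constant coefficient of \<open>t * h\<close> is \<open>- q * coeff h 0\<close>;
  since \<open>q\<close> is nonzero, a zero there allows x to be cancelled from
  \<open>h\<close>.\<close>

lemma t_dvd_pCons_0: "t dvd pCons 0 f \<longleftrightarrow> t dvd f"
proof
  assume "t dvd pCons 0 f"
  then obtain h where h: "pCons 0 f = t * h" by blast
  have "coeff (t * h) 0 = 0" by (simp flip: h)
  then have "coeff h 0 = 0" using q_nz by (simp add: coeff_t_mult)
  then obtain g where "h = pCons 0 g" by (cases h) auto
  with h show "t dvd f" by simp
next
  assume "t dvd f"
  then obtain h where "f = t * h" by blast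
  then have "pCons 0 f = t * pCons 0 h" by simp
  then show "t dvd pCons 0 f" by (metis dvd_triv_left)
qed

lemma t_dvd_monom_mult: "t dvd monom 1 m * f \<longleftrightarrow> t dvd f"
  by (induction m) (simp_all add: monom_Suc t_dvd_pCons_0)

section \<open>Regularity of the domain and of addition\<close>

text \<open>At an index where \<open>h\<close> attains its largest absolute coefficient
  \<open>M\<close>, the product with \<open>q\<close> has size |q| M, of which \<open>s * h\<close>
  can cancel at most (|q| - 1) M; so \<open>M\<close> is at most \<open>B\<close>.\<close>

lemma quotient_bounded:
  assumes "\<And>i. \<bar>coeff (t * h) i\<bar> \<le> B"
  shows "\<bar>coeff h i\<bar> \<le> B"
proof -
  define M where "M = Max ((\<lambda>i. \<bar>coeff h i\<bar>) ` {..degree h})"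
  have "M \<in> (\<lambda>i. \<bar>coeff h i\<bar>) ` {..degree h}"
    unfolding M_def by (rule Max_in) auto
  then obtain j where j: "M = \<bar>coeff h j\<bar>" by auto
  have "\<bar>coeff h k\<bar> \<le> M" if "k \<le> degree h" for k
    unfolding M_def using that by (intro Max_ge) auto
  then have le: "\<bar>coeff h k\<bar> \<le> M" for k
    using j by (cases "k \<le> degree h") (auto simp: coeff_eq_0)
  have M: "0 \<le> M" using j by simp
  have "\<bar>coeff (pCons 0 (s * h)) j\<bar> \<le> norm1 s * M"
    using abs_coeff_mult_le[OF le, of s] M norm1_nonneg[of s] by (cases j) auto
  also have "\<dots> \<le> (\<bar>q\<bar> - 1) * M"
    using norm1_s M by (intro mult_right_mono) auto
  finally have "\<bar>q * coeff h j\<bar> \<le> B + (\<bar>q\<bar> - 1) * M"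
    using assms[of j] unfolding coeff_t_mult by linarith
  then have "M \<le> B" using j by (simp add: abs_mult algebra_simps)
  with le[of i] show ?thesis by linarith
qed

text \<open>The bound is a parameter because letterwise differences and sums of digits leave
  \<open>Sigma q\<close>.\<close>

definition null_words :: "int \<Rightarrow> int list set" where
  "null_words B = {e \<in> lists {-B..B}. t dvd Poly e}"

text \<open>If \<open>e @ v\<close> spells a multiple \<open>t * h\<close>, the low part of \<open>h\<close> determines a carry \<open>r\<close> with
  \<open>t dvd Poly (e @ v) \<longleftrightarrow> t dvd Poly v - r\<close>; as \<open>h\<close> has bounded coefficients, there are finitely
  many carries.\<close>
lemma carry_exists:
  assumes "e @ v \<in> null_words B" and B: "0 \<le> B"
  obtains r where "degree r < n" "\<And>i. \<bar>coeff r i\<bar> \<le> norm1 t * B + B"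
    "\<And>v. t dvd Poly (e @ v) \<longleftrightarrow> t dvd Poly v - r"
proof -
  define m where "m = length e"
  have "t dvd Poly (e @ v)"
    using assms(1) by (simp add: null_words_def)
  then obtain h where h: "Poly (e @ v) = t * h" ..
  have "\<bar>coeff (t * h) i\<bar> \<le> B" for i
    using coeff_Poly_bounded[of "e @ v" B i] assms by (auto simp: h[symmetric] null_words_def)
  then have hB: "\<bar>coeff h i\<bar> \<le> B" for i
    by (rule quotient_bounded)
  define g where "g = poly_cutoff m h"
  have gB: "\<bar>coeff g i\<bar> \<le> B" for i
    using hB[of i] B by (simp add: g_def coeff_poly_cutoff)
  have deg_tg: "coeff (t * g) (j + m) = 0" if "n \<le> j" for j
  proof (cases "g = 0")
    case False
    have "degree g < m"
    proof (rule ccontr)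
      assume "\<not> degree g < m"
      then have "lead_coeff g = 0" by (simp add: g_def coeff_poly_cutoff)
      with False show False by simp
    qed
    then have "degree (t * g) < j + m"
      using degree_mult_le[of t g] that by (simp add: degree_t)
    then show ?thesis by (rule coeff_eq_0)
  qed simp
  \<comment> \<open>Since \<open>Poly e\<close> has no terms from degree \<open>m\<close> on,
    \<open>r\<close> is the part of \<open>t * g\<close> overflowing there, shifted down by
    \<open>m\<close>.\<close>
  define r where "r = - poly_shift m (Poly e - t * g)"
  have r_coeff: "coeff r j = coeff (t * g) (j + m)" for j
    by (simp add: r_def coeff_poly_shift nth_default_def m_def)
  \<comment> \<open>Below degree \<open>m\<close> only the low part \<open>g\<close> of
    \<open>h\<close> contributes to \<open>t * h\<close>, whose coefficients there are the letters
    of \<open>e\<close>.\<close>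
  have low: "coeff (Poly e) i = coeff (t * g) i" if "i < m" for i
  proof -
    have "coeff (t * g) i = coeff (t * h) i"
      unfolding coeff_mult using that by (intro sum.cong) (auto simp: g_def coeff_poly_cutoff)
    then show ?thesis
      using that by (simp flip: h add: nth_default_append m_def nth_default_def nth_append)
  qed
  have eq: "Poly e = t * g - monom 1 m * r"
  proof (rule poly_eqI)
    fix i
    show "coeff (Poly e) i = coeff (t * g - monom 1 m * r) i"
    proof (cases "i < m")
      case True
      then show ?thesis using low[OF True] by (simp add: coeff_monom_mult)
    next
      case False
      then show ?thesis
        by (simp add: coeff_monom_mult r_coeff) (simp add: nth_default_def m_def)
    qed
  qed
  show thesis
  proof
    have "degree r \<le> n - 1"
      by (rule degree_le) (use deg_tg n2 in \<open>auto simp: r_coeff\<close>)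
    then show "degree r < n" using n2 by simp
    show "\<bar>coeff r i\<bar> \<le> norm1 t * B + B" for i
      using abs_coeff_mult_le[OF gB, of t "i + m"] B by (simp add: r_coeff)
    fix v
    have "Poly (e @ v) = t * g + monom 1 m * (Poly v - r)"
      by (simp add: Poly_append eq flip: m_def) (simp add: algebra_simps)
    then show "t dvd Poly (e @ v) \<longleftrightarrow> t dvd Poly v - r"
      by (simp add: dvd_add_right_iff t_dvd_monom_mult)
  qed
qed

lemma regular_null_words:
  assumes B: "0 \<le> B"
  shows "regular (null_words B)"
proof (rule regularI_residuals)
  let ?C = "{r. degree r < n \<and> (\<forall>i. \<bar>coeff r i\<bar> \<le> norm1 t * B + B)}"
  let ?W = "\<lambda>r. {v \<in> lists {-B..B}. t dvd Poly v - r}"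
  show "finite (insert {} (?W ` ?C))"
    using finite_polys_bounded by simp
  fix e
  show "residual (null_words B) e \<in> insert {} (?W ` ?C)"
  proof (cases "residual (null_words B) e = {}")
    case False
    then obtain v where v: "e @ v \<in> null_words B"
      by (auto simp: residual_def)
    obtain r where r: "r \<in> ?C" "\<And>v. t dvd Poly (e @ v) \<longleftrightarrow> t dvd Poly v - r"
      using carry_exists[OF v B] by blast
    have "e \<in> lists {-B..B}" using v by (simp add: null_words_def)
    then have "residual (null_words B) e = ?W r"
      by (auto simp: residual_def null_words_def r(2))
    with r(1) show ?thesis by blast
  qed simp
qed

abbreviation "digits \<equiv> lists (Sigma q)"

lemma Sigma_iff: "a \<in> Sigma q \<longleftrightarrow> \<bar>a\<bar> < \<bar>q\<bar>"
  by (auto simp: Sigma_def)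

lemma zero_in_Sigma: "0 \<in> Sigma q"
  using q_nz by (simp add: Sigma_iff)

lemma Poly_map_diff: "Poly (map (\<lambda>(a, b). a - b) z) = Poly (map fst z) - Poly (map snd z)"
  for z :: "(int \<times> int) list"
  by (induction z) auto

text \<open>Padded with zeros to the length of the word, a smaller equivalent string either ends in 0 or
  is lexicographically smaller.\<close>
lemma Dom_eq:
  "Dom n p q = digits - map snd ` (
     {z. map fst z \<in> digits} \<inter> {z. map snd z \<in> digits} \<inter>
     {z. map (\<lambda>(a, b). a - b) z \<in> null_words (2 * \<bar>q\<bar>)} \<inter>
     ({z. map fst z \<in> {u. u \<noteq> [] \<and> last u = 0}} \<union>
      {z. (map fst z, map snd z) \<in> lex {(a, b). a < b}}))"
  (is "_ = digits - map snd ` ?K")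
proof -
  have "(\<exists>u\<in>digits. (u, w) \<in> lenlex {(a, b). a < b} \<and> str_equiv t u w) \<longleftrightarrow> w \<in> map snd ` ?K"
    if w: "w \<in> digits" for w
  proof
    assume "\<exists>u\<in>digits. (u, w) \<in> lenlex {(a, b). a < b} \<and> str_equiv t u w"
    then obtain u where u: "u \<in> digits" and less: "(u, w) \<in> lenlex {(a, b). a < b}"
      and equiv: "t dvd Poly u - Poly w"
      by (auto simp: str_equiv_def)
    define u' where "u' = u @ replicate (length w - length u) 0"
    define z where "z = zip u' w"
    have len: "length u' = length w"
      using less by (auto simp: u'_def lenlex_conv)
    then have z: "map fst z = u'" "map snd z = w"
      by (simp_all add: z_def)
    have u': "u' \<in> digits"
      using u zero_in_Sigma by (auto simp: u'_def)
    have "t dvd Poly (map (\<lambda>(a, b). a - b) z)"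
      using equiv by (simp add: Poly_map_diff z u'_def)
    moreover have "map (\<lambda>(a, b). a - b) z \<in> lists {- (2 * \<bar>q\<bar>)..2 * \<bar>q\<bar>}"
    proof -
      have "a \<in> Sigma q \<and> b \<in> Sigma q" if "(a, b) \<in> set z" for a b
        using that u' w by (auto simp: z_def in_lists_conv_set dest: set_zip_leftD set_zip_rightD)
      then show ?thesis by (fastforce simp: Sigma_iff in_lists_conv_set)
    qed
    \<comment> \<open>A shorter string gains a final zero by padding; one of equal length is
      unchanged, and then \<open>lenlex\<close> reduces to \<open>lex\<close>.\<close>
    moreover have "u' \<noteq> [] \<and> last u' = 0 \<or> (u', w) \<in> lex {(a, b). a < b}"
    proof (cases "length u < length w")
      case True
      then show ?thesis by (simp add: u'_def)
    next
      case False
      with less show ?thesis by (auto simp: u'_def lenlex_conv)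
    qed
    ultimately have "z \<in> ?K"
      using u' w unfolding Int_iff Un_iff mem_Collect_eq z null_words_def by blast
    then show "w \<in> map snd ` ?K"
      using z(2) by blast
  next
    assume "w \<in> map snd ` ?K"
    then obtain z where z: "z \<in> ?K" "map snd z = w" by blast
    define u where "u = map fst z"
    have len: "length u = length w" using z(2) by (auto simp: u_def)
    have u: "u \<in> digits" using z(1) by (simp add: u_def)
    have "t dvd Poly (map (\<lambda>(a, b). a - b) z)"
      using z(1) by (simp add: null_words_def)
    then have equiv: "t dvd Poly u - Poly w"
      by (simp add: Poly_map_diff z(2) u_def)
    have "u \<noteq> [] \<and> last u = 0 \<or> (u, w) \<in> lex {(a, b). a < b}"
      using z by (auto simp: u_def)
    then show "\<exists>u\<in>digits. (u, w) \<in> lenlex {(a, b). a < b} \<and> str_equiv t u w"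
    proof
      \<comment> \<open>Conversely, dropping the final zero keeps the polynomial and makes the
        string shorter than \<open>w\<close>.\<close>
      assume *: "u \<noteq> [] \<and> last u = 0"
      then have snoc: "u = butlast u @ [0]" by (metis append_butlast_last_id)
      have "Poly (butlast u) = Poly u"
        by (subst snoc) simp
      moreover have "butlast u \<in> digits"
        using u by (auto dest: in_set_butlastD)
      moreover have "length (butlast u) < length w"
        using * len by (cases u) auto
      ultimately show ?thesis
        using equiv by (intro bexI[of _ "butlast u"]) (simp_all add: str_equiv_def lenlex_conv)
    next
      assume "(u, w) \<in> lex {(a, b). a < b}"
      then show ?thesis
        using u equiv len by (intro bexI[of _ u]) (simp_all add: str_equiv_def lenlex_conv)
    qed
  qed
  then show ?thesis
    unfolding Dom_def by blast
qed

lemma regular_Dom: "regular (Dom n p q)"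
  unfolding Dom_eq
  by (intro regular_Diff regular_image_map regular_Int regular_Un regular_lists regular_lex
      regular_vimage_map regular_last regular_null_words) (auto simp: irrefl_def)

section \<open>Unique representatives in \<open>Dom n p q\<close>\<close>

lemma Dom_digits: "w \<in> Dom n p q \<Longrightarrow> w \<in> digits"
  by (simp add: Dom_def)

text \<open>\<open>lenlex\<close> is total, so of two distinct equivalent strings the larger is
  excluded.\<close>

lemma Dom_unique:
  assumes "u \<in> Dom n p q" "w \<in> Dom n p q" "t dvd Poly u - Poly w"
  shows "u = w"
proof (rule ccontr)
  assume "u \<noteq> w"
  moreover have "total (lenlex {(a :: int, b). a < b})"
    by (rule total_lenlex) (auto simp: total_on_def)
  ultimately have "(u, w) \<in> lenlex {(a, b). a < b} \<or> (w, u) \<in> lenlex {(a, b). a < b}"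
    by (auto simp: total_on_def)
  with assms dvd_diff_sym[OF assms(3)] show False
    by (auto simp: Dom_def str_equiv_def)
qed

text \<open>Truncated division of the constant coefficient by \<open>q\<close> emits a digit; replacing the carried
  multiple of \<open>q\<close> by the rest of \<open>t\<close> strictly decreases the sum of absolute coefficients, unless
  the constant coefficient was 0 already.\<close>
lemma digit_representation: "\<exists>w\<in>digits. t dvd f - Poly w"
proof (induction f rule: wf_induct_rule[OF wf_measures[of "[\<lambda>f. nat (norm1 f), \<lambda>f. length (coeffs f)]"]])
  case (1 f)
  show ?case
  proof (cases "f = 0")
    case True
    then show ?thesis by (intro bexI[of _ "[]"]) auto
  next
    case False
    obtain a g where f: "f = pCons a g" by (cases f)
    define k where "k = sgn a * sgn q * (\<bar>a\<bar> div \<bar>q\<bar>)"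
    define d where "d = sgn a * (\<bar>a\<bar> mod \<bar>q\<bar>)"
    have "k * q = sgn a * ((sgn q * q) * (\<bar>a\<bar> div \<bar>q\<bar>))"
      by (simp add: k_def mult_ac)
    also have "sgn q * q = \<bar>q\<bar>"
      by (simp add: abs_sgn mult.commute)
    finally have "d + k * q = sgn a * (\<bar>a\<bar> mod \<bar>q\<bar> + \<bar>q\<bar> * (\<bar>a\<bar> div \<bar>q\<bar>))"
      by (simp only: d_def distrib_left)
    then have a: "a = d + k * q"
      by (simp add: sgn_mult_abs)
    have d: "\<bar>d\<bar> < \<bar>q\<bar>"
      using q_nz pos_mod_bound[of "\<bar>q\<bar>" "\<bar>a\<bar>"]
      by (auto simp: d_def abs_mult abs_sgn_eq)
    \<comment> \<open>Truncation gives nonzero \<open>d\<close> and \<open>k * q\<close> the sign of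
      \<open>a\<close>, so no cancellation occurs.\<close>
    have abs_a: "\<bar>a\<bar> = \<bar>d\<bar> + \<bar>k\<bar> * \<bar>q\<bar>"
      using q_nz pos_imp_zdiv_nonneg_iff[of "\<bar>q\<bar>" "\<bar>a\<bar>"]
      by (cases "a = 0") (simp_all add: d_def k_def abs_mult abs_sgn_eq)
    define f' where "f' = g + smult k s"
    \<comment> \<open>Adding \<open>k\<close> copies of \<open>t\<close> removes
      \<open>k * q\<close> from the constant term and puts \<open>k * s\<close> one degree
      higher.\<close>
    have "f - pCons d f' = smult (-k) t"
      by (simp add: f f'_def t_eq a)
    then have red: "t dvd f - pCons d f'" by (simp add: dvd_smult)
    have "norm1 f' \<le> norm1 g + \<bar>k\<bar> * norm1 s"
      using norm1_add[of g "smult k s"] by (simp add: f'_def norm1_smult)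
    also have "\<bar>k\<bar> * norm1 s \<le> \<bar>k\<bar> * (\<bar>q\<bar> - 1)"
      using norm1_s by (intro mult_left_mono) auto
    finally have le: "norm1 f' \<le> norm1 f - \<bar>d\<bar> - \<bar>k\<bar>"
      by (simp add: f abs_a algebra_simps)
    have "(f', f) \<in> measures [\<lambda>f. nat (norm1 f), \<lambda>f. length (coeffs f)]"
    proof (cases "a = 0")
      case True
      \<comment> \<open>The norm is unchanged, but the zero constant coefficient is dropped, so the
        coefficient list of the nonzero \<open>f\<close> gets shorter.\<close>
      then have "f' = g" by (simp add: f'_def k_def)
      with True False show ?thesis by (auto simp: f cCons_def)
    next
      case False
      then have "0 < \<bar>d\<bar> + \<bar>k\<bar>" using a by (cases "k = 0") auto
      with le norm1_nonneg[of f'] show ?thesis by auto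
    qed
    then obtain w where w: "w \<in> digits" "t dvd f' - Poly w"
      using 1 by blast
    then have "t dvd pCons d f' - Poly (d # w)"
      by (simp add: t_dvd_pCons_0)
    with red have "t dvd f - Poly (d # w)" by (rule dvd_diff_trans)
    moreover have "d # w \<in> digits" using d w(1) by (simp add: Sigma_iff)
    ultimately show ?thesis by blast
  qed
qed

text \<open>The order on all integers is not well-founded; restricting its smaller argument to
  digits bounds it below, and comparisons between digit strings survive the restriction.\<close>

lemma lex_digits_mono:
  assumes "(u, w) \<in> lex {(a, b). a < b}" "u \<in> digits" "w \<in> digits"
  shows "(u, w) \<in> lex {(a, b). a < b \<and> a \<in> Sigma q}"
  using assms by (induction u w rule: list_induct2') auto

text \<open>The least digit string of the class is taken; well-foundedness of the restricted order
  provides it.\<close>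

lemma Dom_representation: "\<exists>w\<in>Dom n p q. t dvd f - Poly w"
proof -
  define r where "r = {(a, b). a < b \<and> a \<in> Sigma q}"
  have "r \<subseteq> measure (\<lambda>a. nat (a + \<bar>q\<bar>))"
    by (auto simp: r_def Sigma_iff)
  then have "wf r" using wf_measure wf_subset by blast
  then have wf: "wf (lenlex r)" by (rule wf_lenlex)
  obtain w0 where "w0 \<in> {w \<in> digits. t dvd f - Poly w}"
    using digit_representation by blast
  then obtain w where w: "w \<in> digits" "t dvd f - Poly w"
    and min: "\<And>u. (u, w) \<in> lenlex r \<Longrightarrow> u \<notin> {w \<in> digits. t dvd f - Poly w}"
    using wfE_min[OF wf] by (metis (no_types, lifting) mem_Collect_eq)
  have "\<not> ((u, w) \<in> lenlex {(a, b). a < b} \<and> str_equiv t u w)" if u: "u \<in> digits" for u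
  proof
    assume *: "(u, w) \<in> lenlex {(a, b). a < b} \<and> str_equiv t u w"
    then have "(u, w) \<in> lenlex r"
      using lex_digits_mono[OF _ u w(1)] by (auto simp: lenlex_conv r_def)
    moreover have "t dvd f - Poly u"
      using * w(2) by (auto simp: str_equiv_def intro: dvd_diff_trans dvd_diff_sym)
    ultimately show False using min u by blast
  qed
  with w show ?thesis by (auto simp: Dom_def)
qed

section \<open>The addition relation\<close>

lemma coeff_Poly_track: "coeff (Poly w) i = (case track w i of None \<Rightarrow> 0 | Some a \<Rightarrow> a)"
  by (simp add: track_def nth_default_def)

abbreviation digit_value :: "int option \<Rightarrow> int" where
  "digit_value x \<equiv> (case x of None \<Rightarrow> 0 | Some a \<Rightarrow> a)"

text \<open>Adds without carrying, with blanks counting as 0; the carries are left to the automaton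
  for \<open>null_words\<close>.\<close>

definition letter_sum :: "int option list \<Rightarrow> int" where
  "letter_sum l = digit_value (l ! 0) + digit_value (l ! 1) - digit_value (l ! 2)"

lemma letter_sum_simp [simp]:
  "letter_sum [a, b, c] = digit_value a + digit_value b - digit_value c"
  by (simp add: letter_sum_def numeral_2_eq_2)

lemma Poly_conv_letter_sum: "Poly (map letter_sum (conv [u, v, w])) = Poly u + Poly v - Poly w"
proof (rule poly_eqI)
  fix i
  show "coeff (Poly (map letter_sum (conv [u, v, w]))) i = coeff (Poly u + Poly v - Poly w) i"
    by (simp only: coeff_add coeff_diff coeff_Poly_track conv_three)
      (auto simp: track_def nth_default_def)
qed

lemma track_digit_bound: "w \<in> digits \<Longrightarrow> \<bar>digit_value (track w i)\<bar> \<le> \<bar>q\<bar>"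
  by (auto simp: track_def in_lists_conv_set Sigma_iff less_imp_le)

lemma conv_add_rel:
  "conv ` add_rel n p q =
    lists {[a, b, c] | a b c. \<not> (a = None \<and> b = None \<and> c = None)} \<inter>
    {z. map (\<lambda>l. l ! 0) z \<in> padded (Dom n p q)} \<inter>
    {z. map (\<lambda>l. l ! 1) z \<in> padded (Dom n p q)} \<inter>
    {z. map (\<lambda>l. l ! 2) z \<in> padded (Dom n p q)} \<inter>
    {z. map letter_sum z \<in> null_words (3 * \<bar>q\<bar>)}" (is "_ = ?R")
proof (intro equalityI subsetI)
  fix z assume "z \<in> conv ` add_rel n p q"
  then obtain u v w where D: "u \<in> Dom n p q" "v \<in> Dom n p q" "w \<in> Dom n p q"
    and eq: "psi n p q w = cls t (Poly u + Poly v)" and z: "z = conv [u, v, w]"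
    by (auto simp: add_rel_def)
  have nth: "z ! i = [track u i, track v i, track w i]" if "i < length z" for i
    using that by (simp add: z conv_three)
  have len: "length z = max (length u) (max (length v) (length w))"
    by (simp add: z conv_three)
  have "t dvd Poly (map letter_sum z)"
    using dvd_diff_sym[of t "Poly w"] eq by (simp add: z Poly_conv_letter_sum psi_def cls_eq_iff)
  moreover have "map letter_sum z \<in> lists {- (3 * \<bar>q\<bar>)..3 * \<bar>q\<bar>}"
  proof -
    have "letter_sum l \<in> {- (3 * \<bar>q\<bar>)..3 * \<bar>q\<bar>}" if "l \<in> set z" for l
    proof -
      from that obtain i where "l = [track u i, track v i, track w i]"
        by (auto simp: in_set_conv_nth nth)
      then show ?thesis
        using D[THEN Dom_digits, THEN track_digit_bound, of i]
        by (simp, intro conjI; linarith)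
    qed
    then show ?thesis by (auto simp: in_lists_conv_set)
  qed
  moreover have "z \<in> lists {[a, b, c] | a b c. \<not> (a = None \<and> b = None \<and> c = None)}"
    using len by (auto simp: in_lists_conv_set in_set_conv_nth nth track_def less_max_iff_disj)
  moreover have "map (\<lambda>l. l ! 0) z \<in> padded (Dom n p q)"
    unfolding map_in_padded_iff using D(1) len by (intro bexI[of _ u]) (auto simp: nth)
  moreover have "map (\<lambda>l. l ! 1) z \<in> padded (Dom n p q)"
    unfolding map_in_padded_iff using D(2) len by (intro bexI[of _ v]) (auto simp: nth)
  moreover have "map (\<lambda>l. l ! 2) z \<in> padded (Dom n p q)"
    unfolding map_in_padded_iff using D(3) len by (intro bexI[of _ w]) (auto simp: nth)
  ultimately show "z \<in> ?R"
    unfolding null_words_def by blast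
next
  fix z assume "z \<in> ?R"
  then have letters: "z \<in> lists {[a, b, c] | a b c. \<not> (a = None \<and> b = None \<and> c = None)}"
    and pads: "map (\<lambda>l. l ! 0) z \<in> padded (Dom n p q)" "map (\<lambda>l. l ! 1) z \<in> padded (Dom n p q)"
      "map (\<lambda>l. l ! 2) z \<in> padded (Dom n p q)"
    and null: "t dvd Poly (map letter_sum z)"
    by (auto simp: null_words_def)
  obtain u where u: "u \<in> Dom n p q" "length u \<le> length z" "\<And>i. i < length z \<Longrightarrow> z ! i ! 0 = track u i"
    using pads(1) unfolding map_in_padded_iff by blast
  obtain v where v: "v \<in> Dom n p q" "length v \<le> length z" "\<And>i. i < length z \<Longrightarrow> z ! i ! 1 = track v i"
    using pads(2) unfolding map_in_padded_iff by blast
  obtain w where w: "w \<in> Dom n p q" "length w \<le> length z" "\<And>i. i < length z \<Longrightarrow> z ! i ! 2 = track w i"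
    using pads(3) unfolding map_in_padded_iff by blast
  have nth: "z ! i = [track u i, track v i, track w i] \<and>
      \<not> (track u i = None \<and> track v i = None \<and> track w i = None)" if "i < length z" for i
  proof -
    have "z ! i \<in> {[a, b, c] | a b c. \<not> (a = None \<and> b = None \<and> c = None)}"
      using letters that by (auto simp: in_lists_conv_set)
    then obtain a b c where "z ! i = [a, b, c]" "\<not> (a = None \<and> b = None \<and> c = None)"
      by blast
    then show ?thesis
      using u(3)[OF that] v(3)[OF that] w(3)[OF that] by (simp add: numeral_2_eq_2)
  qed
  \<comment> \<open>In a longer \<open>z\<close>, the letter at position equal to that maximum would
    be blank on all three tracks.\<close>
  have "length z \<le> max (length u) (max (length v) (length w))"
    using nth[of "max (length u) (max (length v) (length w))"]
    by (intro leI notI) (simp add: track_def)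
  then have "length z = max (length u) (max (length v) (length w))"
    using u(2) v(2) w(2) by simp
  then have z: "z = conv [u, v, w]"
    by (intro nth_equalityI) (auto simp: conv_three nth)
  have "psi n p q w = cls t (Poly u + Poly v)"
    using null dvd_diff_sym[of t "Poly u + Poly v"] by (simp add: z Poly_conv_letter_sum psi_def cls_eq_iff)
  with u(1) v(1) w(1) show "z \<in> conv ` add_rel n p q"
    unfolding z add_rel_def by blast
qed

lemma FA_recognizable_add_rel: "FA_recognizable (add_rel n p q)"
  unfolding FA_recognizable_def conv_add_rel
  by (intro regular_Int regular_lists regular_vimage_map regular_padded regular_Dom
      regular_null_words) simp

section \<open>Non-regularity of the cyclic components\<close>

text \<open>Modulo \<open>q\<close>, the lowest and the highest coefficient of \<open>t\<close> sit in degrees 1 and \<open>n\<close>, and both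
  are invertible, so a multiple of \<open>t\<close> that is nonzero modulo \<open>q\<close> has at least two terms of positive
  degree.  A factor \<open>q\<close> of the cofactor is removed by descent on \<open>k\<close>.\<close>
lemma not_dvd_binomial:
  assumes cop: "coprime (p 1) q" and d: "0 < d" and dvd: "t dvd monom k d - [:l:]"
  shows "k = 0"
  using dvd
proof (induction "nat \<bar>k\<bar>" arbitrary: k l rule: less_induct)
  case less
  from less.prems obtain h where h: "monom k d - [:l:] = t * h" ..
  show ?case
  proof (cases "\<forall>j. q dvd coeff h j")
    case True
    then have "[:q:] dvd h" by (simp add: const_poly_dvd_iff)
    then obtain g where "h = [:q:] * g" ..
    then have g: "monom k d - [:l:] = smult q (t * g)" using h by simp
    then have "coeff (monom k d - [:l:]) i = q * coeff (t * g) i" for i by simp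
    from this[of d] this[of 0] d have kl: "k = q * coeff (t * g) d" "l = q * - coeff (t * g) 0"
      by (auto simp: coeff_pCons split: nat.splits)
    define k' l' where "k' = coeff (t * g) d" and "l' = - coeff (t * g) 0"
    have "smult q (monom k' d - [:l':]) = smult q (t * g)"
      using kl by (simp flip: g k'_def l'_def add: smult_diff_right smult_monom)
    then have "q * coeff (monom k' d - [:l':]) i = q * coeff (t * g) i" for i
      by (metis coeff_smult)
    then have "monom k' d - [:l':] = t * g" using q_nz by (intro poly_eqI) simp
    then have dvd': "t dvd monom k' d - [:l':]" by simp
    show ?thesis
    proof (rule ccontr)
      assume "k \<noteq> 0"
      then have "k' \<noteq> 0" using kl by (auto simp: k'_def)
      moreover have "2 * \<bar>k'\<bar> \<le> \<bar>k\<bar>"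
        using q_ge_2 by (simp add: kl(1) abs_mult mult_right_mono flip: k'_def)
      ultimately have "nat \<bar>k'\<bar> < nat \<bar>k\<bar>" by linarith
      with less.hyps dvd' \<open>k' \<noteq> 0\<close> show False by blast
    qed
  next
    case False
    let ?J = "{j. \<not> q dvd coeff h j}"
    have "?J \<subseteq> {..degree h}"
      by (auto intro!: le_degree)
    then have fin: "finite ?J" using finite_subset by blast
    have ne: "?J \<noteq> {}" using False by blast
    \<comment> \<open>Modulo \<open>q\<close>, the nonzero coefficients of \<open>h\<close> lie
      between \<open>a\<close> and \<open>b\<close>; the extreme coefficients \<open>p 1\<close> and
      1 of \<open>s\<close> are units, so \<open>s * h\<close> survives at \<open>a\<close> and at
      \<open>n - 1 + b\<close>.\<close>
    define a b where "a = Min ?J" and "b = Max ?J"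
    have a: "\<not> q dvd coeff h a" "\<And>j. j < a \<Longrightarrow> q dvd coeff h j"
      using Min_in[OF fin ne] Min_le[OF fin] by (force simp: a_def)+
    have b: "\<not> q dvd coeff h b" "\<And>j. b < j \<Longrightarrow> q dvd coeff h j"
      using Max_in[OF fin ne] Max_ge[OF fin] by (force simp: b_def)+
    have ab: "a \<le> b" using Min_le[OF fin] Max_in[OF fin ne] by (simp add: a_def b_def)
    have sh: "coeff (t * h) (Suc i) = - q * coeff h (Suc i) + coeff (s * h) i" for i
      by (simp add: coeff_t_mult)
    have rhs: "coeff (t * h) (Suc i) = (if Suc i = d then k else 0)" for i
      by (simp flip: h)
    have low: "\<not> q dvd coeff (s * h) a"
    proof -
      have "coeff (s * h) a = coeff s 0 * coeff h a + (\<Sum>i=1..a. coeff s i * coeff h (a - i))"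
        by (simp add: coeff_mult atMost_atLeast0 sum.atLeast_Suc_atMost)
      moreover have "q dvd (\<Sum>i=1..a. coeff s i * coeff h (a - i))"
        by (intro dvd_sum dvd_mult a(2)) auto
      moreover have "\<not> q dvd coeff s 0 * coeff h a"
        using a(1) cop by (simp add: coeff_s_0 coprime_commute coprime_dvd_mult_right_iff)
      ultimately show ?thesis by (simp add: dvd_add_left_iff)
    qed
    have high: "\<not> q dvd coeff (s * h) (n - 1 + b)"
    proof -
      have "coeff (s * h) (n - 1 + b) = (\<Sum>i\<in>insert (n - 1) ({..n - 1 + b} - {n - 1}). coeff s i * coeff h (n - 1 + b - i))"
        unfolding coeff_mult by (rule sum.cong) auto
      also have "\<dots> = coeff h b + (\<Sum>i\<in>{..n - 1 + b} - {n - 1}. coeff s i * coeff h (n - 1 + b - i))"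
        by (subst sum.insert) (simp_all add: coeff_s_top[simplified])
      finally have eq: "coeff (s * h) (n - 1 + b) = \<dots>" .
      have "q dvd coeff s i * coeff h (n - 1 + b - i)" if "i \<in> {..n - 1 + b} - {n - 1}" for i
      proof (cases "i < n - 1")
        case True
        then show ?thesis by (intro dvd_mult b(2)) auto
      next
        case False
        then have "coeff s i = 0" using that by (intro coeff_eq_0) (auto simp: degree_s)
        then show ?thesis by simp
      qed
      then have "q dvd (\<Sum>i\<in>{..n - 1 + b} - {n - 1}. coeff s i * coeff h (n - 1 + b - i))"
        by (rule dvd_sum)
      with b(1) eq show ?thesis by (simp add: dvd_add_left_iff)
    qed
    \<comment> \<open>Multiplication by x raises both degrees by one; both would have to equal the
      only positive exponent \<open>d\<close>, though \<open>a \<le> b\<close> and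
      \<open>2 \<le> n\<close> keep them apart.\<close>
    have "Suc a = d"
      using low sh[of a] rhs[of a] by (auto split: if_splits simp: eq_neg_iff_add_eq_0 add_eq_0_iff)
    moreover have "Suc (n - 1 + b) = d"
      using high sh[of "n - 1 + b"] rhs[of "n - 1 + b"] by (auto split: if_splits simp: add_eq_0_iff)
    ultimately show ?thesis using ab n2 by simp
  qed
qed

lemma comp_preimage_iff:
  "w \<in> comp_preimage n p q i \<longleftrightarrow> w \<in> Dom n p q \<and> (\<exists>k. t dvd Poly w - monom k i)"
  by (simp add: comp_preimage_def psi_def cls_eq_iff)

text \<open>The multiples \<open>monom k i\<close> are pairwise inequivalent, since a nonzero
  difference has degree below \<open>n\<close>; their representatives are therefore
  distinct.\<close>

lemma infinite_comp_preimage: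
  assumes "i < n"
  shows "infinite (comp_preimage n p q i)"
proof -
  have "\<forall>k. \<exists>w. w \<in> Dom n p q \<and> t dvd monom k i - Poly w"
    using Dom_representation by blast
  from choice[OF this] obtain W
    where W: "\<And>k. W k \<in> Dom n p q" "\<And>k. t dvd monom k i - Poly (W k)"
    by blast
  have "inj W"
  proof (rule injI)
    fix k l assume "W k = W l"
    then have "t dvd monom k i - monom l i"
      using W(2)[of k] W(2)[of l] dvd_diff_trans dvd_diff_sym by metis
    then have "t dvd monom (k - l) i" by (simp add: diff_monom)
    then have "monom (k - l) i = 0"
      using t_dvd_small assms degree_monom_le[of "k - l" i] by (meson le_less_trans)
    then show "k = l" by simp
  qed
  then have "infinite (range W)"
    using finite_imageD infinite_UNIV_int by blast
  moreover have "range W \<subseteq> comp_preimage n p q i"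
    using W dvd_diff_sym by (metis comp_preimage_iff image_subsetI)
  ultimately show ?thesis using finite_subset by blast
qed

text \<open>Two prefixes of lengths \<open>m < m'\<close> with a common infinite residual give \<open>D\<close> such that both
  \<open>x ^ m * D\<close> and \<open>x ^ m' * D\<close> lie in the component, so \<open>x ^ (m' - m)\<close> is rational modulo \<open>t\<close>.\<close>
lemma not_regular_comp_preimage:
  assumes cop: "coprime (p 1) q" and i: "i < n"
  shows "\<not> regular (comp_preimage n p q i)"
proof
  let ?L = "comp_preimage n p q i"
  assume "regular ?L"
  moreover have "?L \<subseteq> digits" using Dom_digits comp_preimage_iff by blast
  moreover have "finite (Sigma q)" by (simp add: Sigma_def)
  ultimately obtain u w where len: "length u < length w" and res: "residual ?L u = residual ?L w"
    and inf: "infinite (residual ?L u)"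
    using regular_infinite_shared_residual infinite_comp_preimage[OF i] by metis
  from inf obtain v1 where v1: "v1 \<in> residual ?L u"
    using infinite_imp_nonempty by blast
  have "residual ?L u - {v1} \<noteq> {}" using inf by (metis finite.emptyI infinite_remove)
  then obtain v2 where v2: "v2 \<in> residual ?L u" "v2 \<noteq> v1" by blast
  define D where "D = Poly v1 - Poly v2"
  have diff: "\<exists>k. t dvd monom 1 (length e) * D - monom k i"
    if mem: "v1 \<in> residual ?L e" "v2 \<in> residual ?L e" for e
  proof -
    obtain k1 k2 where "t dvd Poly (e @ v1) - monom k1 i" "t dvd Poly (e @ v2) - monom k2 i"
      using mem unfolding residual_def comp_preimage_iff mem_Collect_eq by blast
    then have "t dvd (Poly (e @ v1) - monom k1 i) - (Poly (e @ v2) - monom k2 i)"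
      by (rule dvd_diff)
    also have "\<dots> = monom 1 (length e) * D - monom (k1 - k2) i"
      by (simp add: Poly_append D_def algebra_simps flip: diff_monom)
    finally show ?thesis ..
  qed
  obtain k where k: "t dvd monom 1 (length u) * D - monom k i"
    using diff v1 v2(1) by blast
  obtain l where l: "t dvd monom 1 (length w) * D - monom l i"
    using diff v1 v2(1) res by blast
  define d where "d = length w - length u"
  have "length w = d + length u" using len by (simp add: d_def)
  then have shift: "monom 1 (length w) * D = monom 1 d * (monom 1 (length u) * D)"
    by (simp add: mult_monom flip: mult.assoc)
  have "t dvd monom 1 d * (monom 1 (length u) * D - monom k i)"
    using k by (rule dvd_mult)
  then have "t dvd monom 1 d * monom k i - monom 1 (length w) * D"
    unfolding shift right_diff_distrib by (rule dvd_diff_sym)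
  then have "t dvd monom 1 d * monom k i - monom l i"
    using l by (rule dvd_diff_trans)
  also have "monom 1 d * monom k i - monom l i = monom 1 i * (monom k d - [:l:])"
    by (simp add: mult_monom algebra_simps smult_monom flip: monom_0)
  \<comment> \<open>The common factor \<open>monom 1 i\<close> can be cancelled because x is not a
    zero divisor modulo \<open>t\<close>.\<close>
  finally have "t dvd monom k d - [:l:]" by (simp add: t_dvd_monom_mult)
  moreover have "0 < d" using len by (simp add: d_def)
  ultimately have "k = 0" using not_dvd_binomial[OF cop] by blast
  \<comment> \<open>With \<open>k = 0\<close>, the words \<open>u @ v1\<close> and
    \<open>u @ v2\<close> are equivalent members of the domain.\<close>
  with k have "t dvd Poly (u @ v1) - Poly (u @ v2)"
    by (simp add: Poly_append D_def algebra_simps)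
  then have "u @ v1 = u @ v2"
    using v1 v2(1) by (intro Dom_unique) (auto simp: residual_def comp_preimage_iff)
  with v2(2) show False by simp
qed

section \<open>From components to projections\<close>

lemma coord_eq:
  assumes "i < n" "t dvd f - monom k i"
  shows "coord t n f i = k"
proof -
  have "(THE r. degree r < n \<and> t dvd f - r) = monom k i"
  proof (rule the_equality)
    show "degree (monom k i) < n \<and> t dvd f - monom k i"
      using assms degree_monom_le[of k i] by (meson le_less_trans)
    fix r assume r: "degree r < n \<and> t dvd f - r"
    have "t dvd r - monom k i"
      using r assms(2) dvd_diff_trans dvd_diff_sym by blast
    moreover have "degree (r - monom k i) < n"
      using r assms(1) degree_monom_le[of k i] by (intro degree_diff_less) auto
    ultimately show "r = monom k i" using t_dvd_small by force
  qed
  then show ?thesis by (simp add: coord_def)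
qed

text \<open>The diagonal of the graph is cut out by a letterwise map, so recognizability of the
  projection would pass to the component.\<close>

lemma comp_preimage_eq_fixed_points:
  assumes "i < n"
  shows "comp_preimage n p q i = {w. map (\<lambda>a. [Some a, Some a]) w \<in> conv ` proj_rel n p q i}"
proof -
  have "w \<in> comp_preimage n p q i \<longleftrightarrow> [w, w] \<in> proj_rel n p q i" for w
    using coord_eq[OF assms, of "Poly w"] by (auto simp: comp_preimage_iff proj_rel_def psi_def cls_eq_iff)
  moreover have "[w, w] \<in> proj_rel n p q i \<longleftrightarrow>
      map (\<lambda>a. [Some a, Some a]) w \<in> conv ` proj_rel n p q i" for w
  proof
    assume "[w, w] \<in> proj_rel n p q i"
    then show "map (\<lambda>a. [Some a, Some a]) w \<in> conv ` proj_rel n p q i"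
      by (metis conv_diagonal imageI)
  next
    assume "map (\<lambda>a. [Some a, Some a]) w \<in> conv ` proj_rel n p q i"
    then obtain u v where uv: "[u, v] \<in> proj_rel n p q i" and eq: "conv [u, v] = map (\<lambda>a. [Some a, Some a]) w"
      by (auto simp: proj_rel_def)
    then show "[w, w] \<in> proj_rel n p q i" using conv_eq_diagonalD[OF eq] by simp
  qed
  ultimately show ?thesis by blast
qed

lemma not_FA_recognizable_proj_rel:
  assumes "coprime (p 1) q" "i < n"
  shows "\<not> FA_recognizable (proj_rel n p q i)"
  using not_regular_comp_preimage[OF assms] regular_vimage_map
  unfolding FA_recognizable_def comp_preimage_eq_fixed_points[OF assms(2)] by blast

end

theorem theorem2:
  fixes n :: nat and p :: "nat \<Rightarrow> int" and q :: int
  assumes "n > 2"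
    and "1 + (\<Sum>i=1..n-1. \<bar>p i\<bar>) < \<bar>q\<bar>"
  shows "regular (Dom n p q)
    \<and> inj_on (psi n p q) (Dom n p q)
    \<and> (\<forall>f :: int poly. \<exists>w \<in> Dom n p q. psi n p q w = cls (tpoly n p q) f)
    \<and> FA_recognizable (add_rel n p q)
    \<and> (gcd (p 1) q = 1 \<longrightarrow>
        (\<forall>i<n. \<not> regular (comp_preimage n p q i) \<and> \<not> FA_recognizable (proj_rel n p q i)))"
proof -
  interpret expanding n p q
    using assms by unfold_locales auto
  have "inj_on (psi n p q) (Dom n p q)"
    by (rule inj_onI) (auto simp: psi_def cls_eq_iff intro: Dom_unique)
  moreover have "\<exists>w \<in> Dom n p q. psi n p q w = cls t f" for f
    using Dom_representation[of f] by (auto simp: psi_def cls_eq_iff intro: dvd_diff_sym)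
  ultimately show ?thesis
    using regular_Dom FA_recognizable_add_rel not_regular_comp_preimage
      not_FA_recognizable_proj_rel by (simp add: coprime_iff_gcd_eq_1)
qed

end
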